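(* Let $A\in\mathbb{R}^{n\times n}$, $B\in\mathbb{R}^{n\times 1}$ (single-input agents), and let $\mathcal{L}$ be the Laplacian of a weighted directed graph on $N$ nodes with eigenvalues $\lambda_1(\mathcal{L})=0,\lambda_2(\mathcal{L}),\dots,\lambda_N(\mathcal{L})$. Suppose (A1') $(A,B)$ is stabilizable and $$\prod_{j}|\lambda_{j}^{u}(A)|<\frac{1}{\inf_{\omega\in\mathbb{R}}\max_{j\in\{2,\dots,N\}}|1-\omega\lambda_{j}(\mathcal{L})|}.$$ Then (A1) holds: there exists $K\in\mathbb{R}^{1\times n}$ such that all eigenvalues of $A-\lambda_{i}(\mathcal{L})BK$, $i=2,\dots,N$, lie in the open unit disk of the complex plane.
   Context: The Laplacian of a weighted directed graph with adjacency matrix $\mathscr{A}=[a_{ij}]$ ($a_{ii}=0$, $a_{ij}\ge0$) is $\mathcal{L}=\mathrm{diag}(\sum_j a_{1j},\dots,\sum_j a_{Nj})-\mathscr{A}$; its eigenvalues (with multiplicity), ordered by ascending real parts, are $\lambda_1(\mathcal{L})=0,\lambda_2(\mathcal{L}),\dots,\lambda_N(\mathcal{L})$. The numbers $\lambda_j^u(A)$ are the unstable eigenvalues of $A$ (those on or outside the unit circle); if $\rho(A)<1$ (spectral radius), the product $\prod_j|\lambda_j^u(A)|$ is defined to be $0$. *)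

theory Defs
  imports "Jordan_Normal_Form.Spectral_Radius" "HOL-Computational_Algebra.Polynomial"
begin

definition cmat :: "real mat \<Rightarrow> complex mat" where
  "cmat M = map_mat complex_of_real M"

definition eigs :: "complex mat \<Rightarrow> complex multiset" where
  "eigs M = proots (char_poly M)"

definition laplacian :: "nat \<Rightarrow> real mat \<Rightarrow> real mat" where
  "laplacian N a = mat N N (\<lambda>(i,j). (if i = j then (\<Sum>k<N. a $$ (i,k)) else 0) - a $$ (i,j))"

text \<open>The multiset of eigenvalues lambda_2(L),...,lambda_N(L): all eigenvalues of L
  (with multiplicity) with the eigenvalue lambda_1(L) = 0 removed once.\<close>
definition lap_eigs :: "nat \<Rightarrow> real mat \<Rightarrow> complex multiset" where
  "lap_eigs N a = eigs (cmat (laplacian N a)) - {#0#}"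

text \<open>Product of the moduli of the unstable eigenvalues (|lambda| >= 1, with multiplicity);
  by convention 0 if the spectral radius is < 1.\<close>
definition unstable_prod :: "real mat \<Rightarrow> real" where
  "unstable_prod A = (if spectral_radius (cmat A) < 1 then 0
     else prod_mset (image_mset norm (filter_mset (\<lambda>z. 1 \<le> norm z) (eigs (cmat A)))))"

definition schur_stable :: "complex mat \<Rightarrow> bool" where
  "schur_stable M \<longleftrightarrow> (\<forall>z. eigenvalue M z \<longrightarrow> norm z < 1)"

definition stabilizable :: "nat \<Rightarrow> nat \<Rightarrow> real mat \<Rightarrow> real mat \<Rightarrow> bool" where
  "stabilizable n m A B \<longleftrightarrow> (\<exists>K \<in> carrier_mat m n. schur_stable (cmat (A - B * K)))"

definition inf_max :: "complex multiset \<Rightarrow> real" where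
  "inf_max \<Lambda> = (INF \<omega>\<in>(UNIV::real set). Max ((\<lambda>z. norm (1 - complex_of_real \<omega> * z)) ` set_mset \<Lambda>))"

end

theory Submission
  imports Defs
begin

text \<open>
  Write \<open>a\<close> for the characteristic polynomial of \<open>A\<close>. The matrix determinant lemma gives
  \<open>char_poly (A - s B K) = a + s f\<close> with \<open>f = K adj(z I - A) B\<close>, and the polynomials \<open>f\<close> together
  with the multiples of \<open>a\<close> form an ideal. It contains \<open>a\<close> and, by stabilizability, a polynomial
  without unstable roots; hence the unstable linear factors of \<open>a\<close> can be cancelled inside the
  ideal, and every multiple of the stable part of \<open>a\<close> with degree \<open>n\<close> and leading coefficient \<open>1\<close>
  has the form \<open>a + f\<close>.

  Let \<open>d\<close> arise from \<open>a\<close> by moving each unstable root \<open>x\<close> to \<open>t / cnj x\<close> with \<open>t < 1\<close> close to \<open>1\<close>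
  (\<open>t = 1\<close> would be the Blaschke reflection, which fixes roots on the unit circle). Then
  \<open>|a| \<le> g |d|\<close> on \<open>|z| \<ge> 1\<close> for a \<open>g\<close> only slightly larger than the product of the unstable
  moduli. With \<open>f = d - a\<close> the closed-loop polynomial is \<open>(1 - s) a + s d\<close>, which has no
  root in \<open>|z| \<ge> 1\<close> as soon as \<open>g |1 - s| < |s|\<close>. This describes a disk with centre
  \<open>c = g\<^sup>2 / (g\<^sup>2 - 1)\<close> and radius \<open>c / g\<close>, so \<open>s = c \<omega> \<lambda>\<close> is admissible whenever
  \<open>|1 - \<omega> \<lambda>| < 1 / g\<close>.
\<close>

section \<open>Reflecting the unstable roots\<close>

text \<open>With \<open>u = cnj w * z\<close> the right-hand side becomes
  \<open>2 * norm (u - t)\<close>. Since (|z|^2 - 1)(|w|^2 - 1) is nonnegative,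
  \<open>norm (z - w)\<close> is at most \<open>norm (u - 1)\<close>, which is the Blaschke case
  \<open>t = 1\<close>. Replacing 1 by \<open>t\<close> costs at most the factor
  \<open>2 / (1 + t)\<close>, attained at \<open>u = -1\<close>.\<close>

lemma norm_diff_reflected_le:
  fixes z w :: complex
  assumes z: "1 \<le> norm z" and w: "1 \<le> norm w" and t: "0 < t" "t < 1"
  shows "(1 + t) * norm (z - w) \<le> 2 * norm w * norm (z - of_real t / cnj w)"
proof -
  define u where "u = cnj w * z"
  have "w \<noteq> 0" using w by auto
  then have "u - of_real t = cnj w * (z - of_real t / cnj w)"
    by (simp add: u_def field_simps)
  then have u: "norm (u - of_real t) = norm w * norm (z - of_real t / cnj w)"
    by (simp add: norm_mult)
  have r: "1 \<le> norm u" using mult_mono[OF w z] by (simp add: u_def norm_mult)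
  have "0 \<le> ((norm z)\<^sup>2 - 1) * ((norm w)\<^sup>2 - 1)"
    using z w by (intro mult_nonneg_nonneg) auto
  also have "\<dots> = (norm (u - 1))\<^sup>2 - (norm (z - w))\<^sup>2"
    unfolding u_def cmod_power2 by (simp add: algebra_simps power2_eq_square)
  finally have "(norm (z - w))\<^sup>2 \<le> (norm (u - 1))\<^sup>2" by simp
  then have le1: "norm (z - w) \<le> norm (u - 1)"
    by (rule power2_le_imp_le) simp
  have u2: "0 \<le> norm u + Re u" using abs_Re_le_cmod[of u] by linarith
  \<comment> \<open>The difference of the squared sides of the next inequality, arranged around
    \<open>norm u - 1\<close> and \<open>norm u + Re u\<close>; both are nonnegative and vanish at
    the extremal point \<open>u = -1\<close>.\<close>
  have "0 \<le> (1 - t) * ((norm u - 1) * (norm u * (3 + t) + (1 + 3 * t)))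
      + 2 * (1 - t)\<^sup>2 * (norm u + Re u)"
    using t r u2 by (intro add_nonneg_nonneg[of "_ * _" "_ * _"] mult_nonneg_nonneg) auto
  also have "\<dots> = 4 * ((norm u)\<^sup>2 - 2 * t * Re u + t\<^sup>2) - (1 + t)\<^sup>2 * ((norm u)\<^sup>2 - 2 * Re u + 1)"
    by (simp add: algebra_simps power2_eq_square)
  also have "\<dots> = (2 * norm (u - of_real t))\<^sup>2 - ((1 + t) * norm (u - 1))\<^sup>2"
    unfolding power_mult_distrib cmod_power2 by (simp add: algebra_simps power2_eq_square)
  finally have "((1 + t) * norm (u - 1))\<^sup>2 \<le> (2 * norm (u - of_real t))\<^sup>2" by simp
  then have le2: "(1 + t) * norm (u - 1) \<le> 2 * norm (u - of_real t)"
    by (rule power2_le_imp_le) simp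
  have "(1 + t) * norm (z - w) \<le> (1 + t) * norm (u - 1)"
    using le1 t by simp
  then show ?thesis using le2 u by simp
qed

definition reflect_root :: "real \<Rightarrow> complex \<Rightarrow> complex" where
  "reflect_root t x = (if 1 \<le> norm x then of_real t / cnj x else x)"

definition stable_reflection :: "real \<Rightarrow> complex poly \<Rightarrow> complex poly" where
  "stable_reflection t p = (\<Prod>x\<in>#proots p. [:- reflect_root t x, 1:])"

lemma norm_reflect_less:
  assumes "0 < t" "t < 1"
  shows "norm (reflect_root t x) < 1"
  using assms by (auto simp: reflect_root_def norm_divide divide_simps)

lemma reflect_root_cnj: "reflect_root t (cnj x) = cnj (reflect_root t x)"
  by (simp add: reflect_root_def)

text \<open>Root by root: an unstable \<open>x\<close> costs the factor
  \<open>2 / (1 + t) * norm x\<close>, a stable one costs nothing because reflection fixes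
  it.\<close>

lemma norm_linear_factors_le_reflected:
  assumes t: "0 < t" "t < 1" and z: "1 \<le> norm z"
  shows "norm (\<Prod>x\<in>#M. z - x) \<le>
    (2 / (1 + t)) ^ size (filter_mset (\<lambda>x. 1 \<le> norm x) M)
    * (\<Prod>x\<in>#filter_mset (\<lambda>x. 1 \<le> norm x) M. norm x) * norm (\<Prod>x\<in>#M. z - reflect_root t x)"
proof (induction M)
  case (add x M)
  let ?G = "\<lambda>M. (2 / (1 + t)) ^ size (filter_mset (\<lambda>x. 1 \<le> norm x) M)
    * (\<Prod>x\<in>#filter_mset (\<lambda>x. 1 \<le> norm x) M. norm x)"
  let ?g = "if 1 \<le> norm x then 2 / (1 + t) * norm x else 1"
  have "norm (z - x) \<le> ?g * norm (z - reflect_root t x)"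
    using norm_diff_reflected_le[OF z _ t, of x] t by (auto simp: reflect_root_def field_simps)
  then have "norm (z - x) * norm (\<Prod>x\<in>#M. z - x)
      \<le> (?g * norm (z - reflect_root t x)) * (?G M * norm (\<Prod>x\<in>#M. z - reflect_root t x))"
    using t by (intro mult_mono add.IH mult_nonneg_nonneg) auto
  also have "\<dots> = ?G (add_mset x M) * (norm (z - reflect_root t x) * norm (\<Prod>x\<in>#M. z - reflect_root t x))"
    by simp
  finally show ?case by (simp add: norm_mult)
qed auto

text \<open>The loss \<open>(2 / (1 + t)) ^ m\<close> tends to 1 as \<open>t\<close> approaches 1
  from below, so any strict room between \<open>c\<close> and \<open>g\<close> absorbs it.\<close>

lemma exists_reflection_parameter:
  fixes c g :: real
  assumes "c < g"
  obtains t :: real where "0 < t" "t < 1" "(2 / (1 + t)) ^ m * c < g"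
proof -
  have "((\<lambda>t. (2 / (1 + t)) ^ m * c) \<longlongrightarrow> (2 / (1 + 1)) ^ m * c) (at_left (1::real))"
    by (intro tendsto_intros) auto
  then have "\<forall>\<^sub>F t in at_left 1. (2 / (1 + t)) ^ m * c < g"
    using assms by (intro order_tendstoD) auto
  moreover have "\<forall>\<^sub>F t in at_left (1::real). t \<in> {0<..<1}"
    by (rule eventually_at_left_real) auto
  ultimately have "\<forall>\<^sub>F t in at_left (1::real). 0 < t \<and> t < 1 \<and> (2 / (1 + t)) ^ m * c < g"
    by eventually_elim auto
  then show thesis
    using that eventually_happens' trivial_limit_at_left_real by blast
qed

text \<open>Completing the square: because (g^2 - 1) c = g^2, the positive quantity (g^2 -
  1)((c/g)^2 - |s - c|^2) equals |s|^2 - g^2 |1 - s|^2.\<close>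

lemma norm_gt_Apollonius:
  fixes s :: complex
  assumes g: "1 < g" and c: "c = g\<^sup>2 / (g\<^sup>2 - 1)" and s: "norm (s - of_real c) < c / g"
  shows "g * norm (1 - s) < norm s"
proof -
  have g2: "g\<^sup>2 - 1 > 0" using g by simp
  then have gc: "(g\<^sup>2 - 1) * c = g\<^sup>2" by (simp add: c)
  have "(norm (s - of_real c))\<^sup>2 < (c / g)\<^sup>2"
    using s by (intro power_strict_mono) auto
  then have "0 < (g\<^sup>2 - 1) * ((c / g)\<^sup>2 - (norm (s - of_real c))\<^sup>2)"
    using g2 by simp
  also have "\<dots> = (g\<^sup>2 - 1) * (c / g)\<^sup>2 - (g\<^sup>2 - 1) * c\<^sup>2 + 2 * ((g\<^sup>2 - 1) * c) * Re s - (g\<^sup>2 - 1) * (norm s)\<^sup>2"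
    unfolding cmod_power2 by (simp add: algebra_simps power2_eq_square)
  also note gc
  also have "(g\<^sup>2 - 1) * (c / g)\<^sup>2 - (g\<^sup>2 - 1) * c\<^sup>2 = - g\<^sup>2"
  proof -
    have "(g\<^sup>2 - 1) * (c / g)\<^sup>2 = ((g\<^sup>2 - 1) * c) * c / g\<^sup>2"
      by (simp add: power2_eq_square)
    also have "\<dots> = c" unfolding gc using g by simp
    finally show ?thesis using gc by (simp add: algebra_simps power2_eq_square)
  qed
  also have "- g\<^sup>2 + 2 * g\<^sup>2 * Re s - (g\<^sup>2 - 1) * (norm s)\<^sup>2 = (norm s)\<^sup>2 - (g * norm (1 - s))\<^sup>2"
    unfolding power_mult_distrib cmod_power2 by (simp add: algebra_simps power2_eq_square)
  finally have "(g * norm (1 - s))\<^sup>2 < (norm s)\<^sup>2" by simp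
  then show ?thesis by (rule power_less_imp_less_base) simp
qed

section \<open>Conjugation and products of linear factors\<close>

lemma comm_ring_hom_cnj: "comm_ring_hom cnj"
  by unfold_locales auto

lemma map_poly_cnj_linear_factors:
  "map_poly cnj (\<Prod>x\<in>#M. [:- f x, 1:]) = (\<Prod>x\<in>#M. [:- cnj (f x), 1:])"
proof -
  interpret c: comm_ring_hom cnj by (rule comm_ring_hom_cnj)
  interpret m: map_poly_comm_ring_hom cnj ..
  show ?thesis by (induction M) (simp_all add: m.hom_mult del: mult_pCons_left mult_pCons_right)
qed

lemma proots_linear_factors: "proots (\<Prod>x\<in>#M. [:- x, 1:]) = (M :: 'a :: idom multiset)"
proof (induction M)
  case (add x M)
  have "(\<Prod>x\<in>#M. [:- x, 1:]) \<noteq> 0"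
    by auto
  then show ?case using add by (simp add: proots_mult del: mult_pCons_left)
qed simp

lemma monic_complex_poly_decompose:
  fixes p :: "complex poly"
  assumes "lead_coeff p = 1"
  shows "(\<Prod>x\<in>#proots p. [:- x, 1:]) = p"
  using complex_poly_decompose_multiset[of p] assms by simp

text \<open>The root multiset of a real polynomial is closed under conjugation, and
  \<open>reflect_root\<close> commutes with conjugation. Realness of the reflected polynomial is
  what later permits a real gain.\<close>

lemma map_poly_cnj_stable_reflection:
  assumes monic: "lead_coeff p = 1" and real: "map_poly cnj p = p"
  shows "map_poly cnj (stable_reflection t p) = stable_reflection t p"
proof -
  have "p = (\<Prod>x\<in>#proots p. [:- cnj x, 1:])"
    using map_poly_cnj_linear_factors[of "\<lambda>x. x" "proots p"]
    by (simp add: monic_complex_poly_decompose[OF monic] real)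
  also have "\<dots> = (\<Prod>x\<in>#image_mset cnj (proots p). [:- x, 1:])"
    by (simp add: image_mset.compositionality o_def)
  finally have inv: "proots p = image_mset cnj (proots p)"
    using proots_linear_factors by metis
  have "map_poly cnj (stable_reflection t p) = (\<Prod>x\<in>#proots p. [:- reflect_root t (cnj x), 1:])"
    by (simp add: stable_reflection_def map_poly_cnj_linear_factors reflect_root_cnj)
  also have "\<dots> = (\<Prod>x\<in>#image_mset cnj (proots p). [:- reflect_root t x, 1:])"
    by (simp add: image_mset.compositionality o_def)
  finally show ?thesis by (simp add: stable_reflection_def flip: inv)
qed

lemma lead_coeff_linear_factors:
  "lead_coeff (\<Prod>x\<in>#M. [:- f x, 1 :: 'a :: idom:]) = 1"
proof (induction M)
  case (add x M)
  show ?case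
    unfolding image_mset_add_mset prod_mset.add_mset lead_coeff_mult add.IH by simp
qed simp

lemma degree_linear_factors_mset:
  "degree (\<Prod>x\<in>#M. [:- f x, 1 :: 'a :: idom:]) = size M"
proof (induction M)
  case (add x M)
  have "(\<Prod>x\<in>#M. [:- f x, 1:]) \<noteq> 0" by auto
  then show ?case using add by (simp add: degree_mult_eq del: mult_pCons_left)
qed simp

lemma poly_linear_factors:
  "poly (\<Prod>x\<in>#M. [:- f x, 1 :: 'a :: comm_ring_1:]) z = (\<Prod>x\<in>#M. z - f x)"
  by (induction M) (auto simp: algebra_simps)

text \<open>Exhibits the reflected polynomial as a multiple of the stable part of \<open>p\<close>,
  the form in which ideal membership can be shown.\<close>

lemma stable_reflection_split:
  "stable_reflection t p = (\<Prod>x\<in>#filter_mset (\<lambda>x. 1 \<le> norm x) (proots p). [:- reflect_root t x, 1:])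
     * (\<Prod>x\<in>#filter_mset (\<lambda>x. \<not> 1 \<le> norm x) (proots p). [:- x, 1:])"
proof -
  have "(\<Prod>x\<in>#M. [:- reflect_root t x, 1:]) =
    (\<Prod>x\<in>#filter_mset (\<lambda>x. 1 \<le> norm x) M. [:- reflect_root t x, 1:])
     * (\<Prod>x\<in>#filter_mset (\<lambda>x. \<not> 1 \<le> norm x) M. [:- x, 1:])" for M
    by (induction M) (auto simp: reflect_root_def mult_ac simp del: mult_pCons_left mult_pCons_right)
  then show ?thesis unfolding stable_reflection_def by blast
qed

section \<open>Characteristic polynomials under rank-one feedback\<close>

text \<open>The matrix determinant lemma in adjugate form, suited to polynomial matrices, which are
  rarely invertible. The determinant of the bordered matrix \<open>P\<close> is found twice, by
  column elimination with \<open>Q\<close> and by row elimination with \<open>R\<close>; the second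
  computation carries a factor \<open>D ^ n\<close>, which \<open>nz\<close> allows to be
  cancelled.\<close>

lemma det_add_rank_one:
  fixes M :: "'a :: idom mat"
  assumes M: "M \<in> carrier_mat n n" and U: "U \<in> carrier_mat n 1" and W: "W \<in> carrier_mat 1 n"
    and nz: "det M \<noteq> 0"
  shows "det (M + U * W) = det M + (W * (adj_mat M * U)) $$ (0,0)"
proof -
  note adj = adj_mat[OF M]
  define D where "D = det M"
  define P where "P = four_block_mat M U (- W) (1\<^sub>m 1)"
  define Q where "Q = four_block_mat (1\<^sub>m n) (0\<^sub>m n 1) W (1\<^sub>m 1)"
  \<comment> \<open>Schur complement elimination multiplied through by \<open>D = det M\<close>, so
    that the adjugate replaces the inverse.\<close>
  define R where "R = four_block_mat (adj_mat M) (0\<^sub>m n 1) (W * adj_mat M) (D \<cdot>\<^sub>m 1\<^sub>m 1)"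
  have P: "P \<in> carrier_mat (n + 1) (n + 1)" and Q: "Q \<in> carrier_mat (n + 1) (n + 1)"
    and R: "R \<in> carrier_mat (n + 1) (n + 1)"
    unfolding P_def Q_def R_def using M U W adj by auto
  have X: "W * (adj_mat M * U) \<in> carrier_mat 1 1" using W U adj by auto
  have "P * Q = four_block_mat (M * 1\<^sub>m n + U * W) (M * 0\<^sub>m n 1 + U * 1\<^sub>m 1)
      (- W * 1\<^sub>m n + 1\<^sub>m 1 * W) (- W * 0\<^sub>m n 1 + 1\<^sub>m 1 * 1\<^sub>m 1)"
    unfolding P_def Q_def by (rule mult_four_block_mat) (use M U W in auto)
  also have "\<dots> = four_block_mat (M + U * W) U (0\<^sub>m 1 n) (1\<^sub>m 1)"
    using M U W by (intro cong_four_block_mat) (auto simp: uminus_l_inv_mat)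
  finally have PQ: "P * Q = four_block_mat (M + U * W) U (0\<^sub>m 1 n) (1\<^sub>m 1)" .
  have "det P * det Q = det (M + U * W)"
    unfolding det_mult[OF P Q, symmetric] PQ
    by (subst det_four_block_mat_lower_left_zero[of _ n _ 1]) (use M U W in auto)
  moreover have "det Q = 1"
    unfolding Q_def by (subst det_four_block_mat_upper_right_zero[of _ n _ 1]) (use W in auto)
  ultimately have detP: "det P = det (M + U * W)" by simp
  have "R * P = four_block_mat (adj_mat M * M + 0\<^sub>m n 1 * - W) (adj_mat M * U + 0\<^sub>m n 1 * 1\<^sub>m 1)
      (W * adj_mat M * M + D \<cdot>\<^sub>m 1\<^sub>m 1 * - W) (W * adj_mat M * U + D \<cdot>\<^sub>m 1\<^sub>m 1 * 1\<^sub>m 1)"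
    unfolding P_def R_def by (rule mult_four_block_mat) (use M U W adj in auto)
  also have "\<dots> = four_block_mat (D \<cdot>\<^sub>m 1\<^sub>m n) (adj_mat M * U) (0\<^sub>m 1 n)
      (W * (adj_mat M * U) + D \<cdot>\<^sub>m 1\<^sub>m 1)"
  proof (intro cong_four_block_mat)
    have "W * adj_mat M * M = W * (D \<cdot>\<^sub>m 1\<^sub>m n)"
      using W M adj by (simp add: assoc_mult_mat[of _ 1 n _ n _ n] D_def)
    also have "\<dots> = D \<cdot>\<^sub>m W" using W
      by (metis mult_smult_distrib one_carrier_mat right_mult_one_mat)
    also have "D \<cdot>\<^sub>m W + D \<cdot>\<^sub>m 1\<^sub>m 1 * - W = 0\<^sub>m 1 n"
      using W by (intro eq_matI) auto
    finally show "W * adj_mat M * M + D \<cdot>\<^sub>m 1\<^sub>m 1 * - W = 0\<^sub>m 1 n" .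
  qed (use M U W adj in \<open>auto simp: D_def assoc_mult_mat[of _ 1 n _ n _ 1]\<close>)
  finally have RP: "R * P = \<dots>" .
  have "det R * det P = D ^ n * det (W * (adj_mat M * U) + D \<cdot>\<^sub>m 1\<^sub>m 1)"
    unfolding det_mult[OF R P, symmetric] RP
    by (subst det_four_block_mat_lower_left_zero[of _ n _ 1]) (use M U W adj in auto)
  moreover have "det R = D ^ n"
  proof -
    have "det R = det (adj_mat M) * det M"
      unfolding R_def by (subst det_four_block_mat_upper_right_zero[of _ n _ 1]) (use W adj in \<open>auto simp: D_def\<close>)
    also have "\<dots> = D ^ n" unfolding det_mult[OF adj(1) M, symmetric] adj by (simp add: D_def)
    finally show ?thesis .
  qed
  moreover have "det (W * (adj_mat M * U) + D \<cdot>\<^sub>m 1\<^sub>m 1) = (W * (adj_mat M * U)) $$ (0,0) + D"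
    using X by (subst det_single) auto
  ultimately show ?thesis using nz detP by (simp add: D_def add.commute)
qed

section \<open>The feedback polynomial and its dependence on the gain\<close>

abbreviation const_mat :: "'a :: zero mat \<Rightarrow> 'a poly mat" where
  "const_mat \<equiv> map_mat (\<lambda>x. [:x:])"

text \<open>The numerator of the transfer function K (zI - A)^{-1} B over the denominator
  \<open>char_poly A\<close>.\<close>

definition feedback_poly :: "'a :: comm_ring_1 mat \<Rightarrow> 'a mat \<Rightarrow> 'a mat \<Rightarrow> 'a poly" where
  "feedback_poly A B K =
     (const_mat K * (adj_mat (char_poly_matrix A) * const_mat B)) $$ (0,0)"

lemma const_mat_mult:
  fixes X Y :: "'a :: comm_ring_1 mat"
  assumes "X \<in> carrier_mat r n" "Y \<in> carrier_mat n c"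
  shows "const_mat (X * Y) = const_mat X * const_mat Y"
proof -
  interpret comm_ring_hom "\<lambda>x :: 'a. [:x:]"
    by unfold_locales (auto simp: one_pCons)
  show ?thesis using assms by (rule mat_hom_mult)
qed

lemma char_poly_nonzero:
  fixes A :: "'a :: comm_ring_1 mat"
  assumes A: "A \<in> carrier_mat n n"
  shows "char_poly A \<noteq> 0"
  using degree_monic_char_poly[OF A] by auto

text \<open>Feedback perturbs the characteristic matrix by a product of a column and a row, so the
  determinant lemma applies over the polynomial ring; absorbing \<open>s\<close> into the row shows
  that the dependence on \<open>s\<close> is affine.\<close>

lemma char_poly_feedback:
  fixes A :: "'a :: idom mat"
  assumes A: "A \<in> carrier_mat n n" and B: "B \<in> carrier_mat n 1" and K: "K \<in> carrier_mat 1 n"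
  shows "char_poly (A - s \<cdot>\<^sub>m (B * K)) = char_poly A + Polynomial.smult s (feedback_poly A B K)"
proof -
  let ?M = "char_poly_matrix A" and ?U = "const_mat B" and ?W = "const_mat (s \<cdot>\<^sub>m K)"
  have BK: "B * (s \<cdot>\<^sub>m K) = s \<cdot>\<^sub>m (B * K)"
    using B K by (rule mult_smult_distrib)
  have M: "?M \<in> carrier_mat n n" and U: "?U \<in> carrier_mat n 1" and W: "?W \<in> carrier_mat 1 n"
    using A B K by auto
  have "char_poly_matrix (A - s \<cdot>\<^sub>m (B * K)) = ?M + const_mat (s \<cdot>\<^sub>m (B * K))"
    using A B K unfolding char_poly_matrix_def by (intro eq_matI) auto
  also have "\<dots> = ?M + ?U * ?W"
    unfolding BK[symmetric] by (subst const_mat_mult[of _ n 1 _ n]) (use B K in auto)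
  finally have "char_poly (A - s \<cdot>\<^sub>m (B * K)) = char_poly A + (?W * (adj_mat ?M * ?U)) $$ (0,0)"
    using det_add_rank_one[OF M U W] char_poly_nonzero[OF A] by (simp add: char_poly_def)
  moreover have "?W = [:s:] \<cdot>\<^sub>m const_mat K"
    by (intro eq_matI) auto
  ultimately show ?thesis
    using K U adj_mat(1)[OF M] by (simp add: feedback_poly_def)
qed

lemma feedback_poly_add:
  assumes A: "A \<in> carrier_mat n n" and B: "B \<in> carrier_mat n 1"
    and K: "K \<in> carrier_mat 1 n" and L: "L \<in> carrier_mat 1 n"
  shows "feedback_poly A B (K + L) = feedback_poly A B K + feedback_poly A B L"
proof -
  have "const_mat (K + L) = const_mat K + const_mat L"
    using K L by (intro eq_matI) auto
  moreover have "adj_mat (char_poly_matrix A) * const_mat B \<in> carrier_mat n 1"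
    using adj_mat(1)[OF char_poly_matrix_closed[OF A]] B by auto
  ultimately show ?thesis
    unfolding feedback_poly_def using B K L
    by (simp add: add_mult_distrib_mat[of _ 1 n])
qed

lemma feedback_poly_smult:
  assumes A: "A \<in> carrier_mat n n" and B: "B \<in> carrier_mat n 1" and K: "K \<in> carrier_mat 1 n"
  shows "feedback_poly A B (s \<cdot>\<^sub>m K) = Polynomial.smult s (feedback_poly A B K)"
proof -
  have "const_mat (s \<cdot>\<^sub>m K) = [:s:] \<cdot>\<^sub>m const_mat K"
    by (intro eq_matI) auto
  then show ?thesis
    unfolding feedback_poly_def using K B adj_mat(1)[OF char_poly_matrix_closed[OF A]]
    by simp
qed

text \<open>From (zI - A) J = a I for the adjugate J follows z J = A J + a I; multiply by
  \<open>K\<close> on the left and \<open>B\<close> on the right. Multiplication by z thus turns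
  \<open>K\<close> into \<open>K * A\<close> up to a multiple of \<open>char_poly A\<close>, which
  is why such multiples are adjoined in \<open>feedback_ideal\<close>.\<close>

lemma feedback_poly_shift:
  assumes A: "A \<in> carrier_mat n n" and B: "B \<in> carrier_mat n 1" and K: "K \<in> carrier_mat 1 n"
  shows "[:0,1:] * feedback_poly A B K
    = feedback_poly A B (K * A) + Polynomial.smult ((K * B) $$ (0,0)) (char_poly A)"
proof -
  let ?M = "char_poly_matrix A"
  let ?J = "adj_mat ?M"
  have M: "?M \<in> carrier_mat n n" using A by auto
  have J: "?J \<in> carrier_mat n n" by (rule adj_mat(1)[OF M])
  have Kc: "const_mat K \<in> carrier_mat 1 n" and Bc: "const_mat B \<in> carrier_mat n 1"
    and Ac: "const_mat A \<in> carrier_mat n n" using A B K by auto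
  have "[:0,1:] \<cdot>\<^sub>m 1\<^sub>m n = const_mat A + ?M"
    unfolding char_poly_matrix_def using A by (intro eq_matI) auto
  then have "([:0,1:] \<cdot>\<^sub>m 1\<^sub>m n) * ?J = const_mat A * ?J + ?M * ?J"
    using Ac M J by (simp add: add_mult_distrib_mat[of _ n n])
  then have XJ: "[:0,1:] \<cdot>\<^sub>m ?J = const_mat A * ?J + char_poly A \<cdot>\<^sub>m 1\<^sub>m n"
    using J mult_smult_assoc_mat[OF one_carrier_mat J, of "[:0,1:]"]
    by (simp add: adj_mat(2)[OF M] char_poly_def)
  have "[:0,1:] \<cdot>\<^sub>m (const_mat K * (?J * const_mat B)) = const_mat K * (([:0,1:] \<cdot>\<^sub>m ?J) * const_mat B)"
    unfolding mult_smult_assoc_mat[OF J Bc]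
    by (rule mult_smult_distrib[OF Kc mult_carrier_mat[OF J Bc], symmetric])
  also have "\<dots> = const_mat K * (const_mat A * ?J * const_mat B + char_poly A \<cdot>\<^sub>m const_mat B)"
    unfolding XJ using Ac Bc J mult_smult_assoc_mat[OF one_carrier_mat Bc, of "char_poly A"]
    by (subst add_mult_distrib_mat[of _ n n _ _ 1]) auto
  also have "\<dots> = const_mat K * (const_mat A * (?J * const_mat B)) + char_poly A \<cdot>\<^sub>m (const_mat K * const_mat B)"
    using Ac Bc J Kc by (subst mult_add_distrib_mat[of _ 1 n _ 1])  auto
  also have "const_mat K * (const_mat A * (?J * const_mat B)) = const_mat (K * A) * (?J * const_mat B)"
    unfolding const_mat_mult[OF K A] using Ac Bc J Kc
    by (intro assoc_mult_mat[symmetric]) auto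
  also have "const_mat K * const_mat B = const_mat (K * B)"
    using const_mat_mult[OF K B] by simp
  finally have "([:0,1:] \<cdot>\<^sub>m (const_mat K * (?J * const_mat B))) $$ (0,0) =
      (const_mat (K * A) * (?J * const_mat B) + char_poly A \<cdot>\<^sub>m const_mat (K * B)) $$ (0,0)"
    by simp
  then show ?thesis
    unfolding feedback_poly_def using A B K J by (simp add: mult.commute)
qed

section \<open>The ideal of feedback polynomials and pole placement\<close>

definition feedback_ideal :: "'a :: comm_ring_1 mat \<Rightarrow> 'a mat \<Rightarrow> 'a poly set" where
  "feedback_ideal A B =
     {feedback_poly A B K + char_poly A * q | K q. K \<in> carrier_mat 1 (dim_row A)}"

lemma feedback_idealI:
  assumes "A \<in> carrier_mat n n" "K \<in> carrier_mat 1 n"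
    and "p = feedback_poly A B K + char_poly A * q"
  shows "p \<in> feedback_ideal A B"
  using assms unfolding feedback_ideal_def by auto

lemma feedback_ideal_add:
  assumes A: "A \<in> carrier_mat n n" and B: "B \<in> carrier_mat n 1"
    and "p \<in> feedback_ideal A B" "q \<in> feedback_ideal A B"
  shows "p + q \<in> feedback_ideal A B"
proof -
  from assms obtain K L u v where K: "K \<in> carrier_mat 1 n" and L: "L \<in> carrier_mat 1 n"
    and p: "p = feedback_poly A B K + char_poly A * u"
    and q: "q = feedback_poly A B L + char_poly A * v"
    unfolding feedback_ideal_def by auto
  have "p + q = feedback_poly A B (K + L) + char_poly A * (u + v)"
    unfolding p q feedback_poly_add[OF A B K L] by (simp add: algebra_simps)
  then show ?thesis
    by (rule feedback_idealI[OF A, rotated]) (use A K L in auto)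
qed

lemma feedback_ideal_smult:
  assumes A: "A \<in> carrier_mat n n" and B: "B \<in> carrier_mat n 1"
    and "p \<in> feedback_ideal A B"
  shows "Polynomial.smult c p \<in> feedback_ideal A B"
proof -
  from assms obtain K u where K: "K \<in> carrier_mat 1 n"
    and p: "p = feedback_poly A B K + char_poly A * u"
    unfolding feedback_ideal_def by auto
  have "Polynomial.smult c p = feedback_poly A B (c \<cdot>\<^sub>m K) + char_poly A * Polynomial.smult c u"
    unfolding p feedback_poly_smult[OF A B K] by (simp add: smult_add_right)
  then show ?thesis
    by (rule feedback_idealI[OF A, rotated]) (use A K in auto)
qed

lemma feedback_ideal_shift:
  assumes A: "A \<in> carrier_mat n n" and B: "B \<in> carrier_mat n 1"
    and "p \<in> feedback_ideal A B"
  shows "[:0,1:] * p \<in> feedback_ideal A B"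
proof -
  from assms obtain K u where K: "K \<in> carrier_mat 1 n"
    and p: "p = feedback_poly A B K + char_poly A * u"
    unfolding feedback_ideal_def by auto
  have "[:0,1:] * p = feedback_poly A B (K * A) + char_poly A * ([:(K * B) $$ (0,0):] + [:0,1:] * u)"
    unfolding p distrib_left feedback_poly_shift[OF A B K] by (simp add: algebra_simps)
  then show ?thesis
    by (rule feedback_idealI[OF A, rotated]) (use A K in auto)
qed

text \<open>Scaling by constants and multiplication by z generate multiplication by every
  polynomial.\<close>

lemma feedback_ideal_mult:
  assumes A: "A \<in> carrier_mat n n" and B: "B \<in> carrier_mat n 1"
    and p: "p \<in> feedback_ideal A B"
  shows "r * p \<in> feedback_ideal A B"
proof (induction r)
  case 0
  then show ?case using feedback_ideal_smult[OF A B p, of 0] by simp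
next
  case (pCons c r)
  have "pCons c r * p = Polynomial.smult c p + [:0,1:] * (r * p)" by simp
  then show ?case
    using feedback_ideal_add[OF A B feedback_ideal_smult[OF A B p]
        feedback_ideal_shift[OF A B pCons.IH]] by metis
qed

lemma char_poly_in_feedback_ideal:
  assumes A: "A \<in> carrier_mat n n" and B: "B \<in> carrier_mat n 1"
  shows "char_poly A \<in> feedback_ideal A B"
proof -
  \<comment> \<open>The zero gain is written as a zero multiple so that linearity in the gain makes
    its feedback polynomial vanish.\<close>
  have "char_poly A = feedback_poly A B (0 \<cdot>\<^sub>m 0\<^sub>m 1 n) + char_poly A * 1"
    by (simp only: feedback_poly_smult[OF A B zero_carrier_mat]) simp
  then show ?thesis
    by (rule feedback_idealI[OF A, rotated]) auto
qed

lemma closed_loop_in_feedback_ideal: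
  fixes A :: "'a :: idom mat"
  assumes A: "A \<in> carrier_mat n n" and B: "B \<in> carrier_mat n 1" and K: "K \<in> carrier_mat 1 n"
  shows "char_poly (A - B * K) \<in> feedback_ideal A B"
proof -
  have "1 \<cdot>\<^sub>m (B * K) = B * K" by (intro eq_matI) auto
  then have "char_poly (A - B * K) = feedback_poly A B K + char_poly A * 1"
    using char_poly_feedback[OF A B K, of 1] by (simp add: add.commute)
  then show ?thesis
    by (rule feedback_idealI[OF A, rotated]) (use A K in auto)
qed

text \<open>A linear factor whose root is not a root of \<open>d\<close> is coprime to
  \<open>d\<close>. Writing d = (z - x) h + c with a nonzero constant c, the Bezout identity p = (p
  d - h (z - x) p) / c recovers \<open>p\<close> from two members of \<open>I\<close>; the factors
  are removed one at a time.\<close>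

lemma ideal_cancel_linear_factors:
  fixes I :: "'a :: field poly set"
  assumes add: "\<And>p q. p \<in> I \<Longrightarrow> q \<in> I \<Longrightarrow> p + q \<in> I"
    and mult: "\<And>r p. p \<in> I \<Longrightarrow> r * p \<in> I"
    and d: "d \<in> I" and "\<forall>x\<in>#U. poly d x \<noteq> 0"
    and "(\<Prod>x\<in>#U. [:-x, 1:]) * p \<in> I"
  shows "p \<in> I"
  using assms(4,5)
proof (induction U arbitrary: p)
  case (add x U)
  have "[:-x, 1:] * p \<in> I"
    by (rule add.IH) (use add.prems in \<open>auto simp: mult_ac simp del: mult_pCons_left mult_pCons_right\<close>)
  moreover define c h where "c = poly d x" and "h = synthetic_div d x"
  have c: "c \<noteq> 0" and dh: "d = [:-x, 1:] * h + [:c:]"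
    using add.prems synthetic_div_correct'[of x d] by (auto simp: c_def h_def)
  have "p = [:1 / c:] * (p * d + (- h) * ([:-x, 1:] * p))"
    using c unfolding dh by (simp add: algebra_simps)
  ultimately show ?case using assms(1) mult d by metis
qed simp

text \<open>The leading terms of \<open>p\<close> and \<open>q\<close> cancel, whereas a nonzero
  multiple of \<open>a\<close> has degree at least \<open>n\<close>.\<close>

lemma monic_diff_eq_multiple:
  fixes p q a r :: "'a :: idom poly"
  assumes "degree p = n" "coeff p n = 1" "degree q = n" "coeff q n = 1" "degree a = n" "a \<noteq> 0"
    and eq: "p - q = a * r"
  shows "p = q"
proof (rule ccontr)
  assume "p \<noteq> q"
  then have "a * r \<noteq> 0" using eq by auto
  then have "n \<le> degree (p - q)" unfolding eq using assms by (simp add: degree_mult_eq)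
  moreover have "degree (p - q) \<le> n" using assms by (intro degree_diff_le) auto
  ultimately have "lead_coeff (p - q) = coeff p n - coeff q n" by simp
  then show False using assms \<open>p \<noteq> q\<close> by (metis leading_coeff_0_iff right_minus_eq)
qed

text \<open>Pole placement: \<open>d\<close> differs from the closed-loop polynomial of its own gain
  by a multiple of \<open>char_poly A\<close>, and both are monic of degree \<open>n\<close>, so
  they coincide.\<close>

lemma feedback_of_closed_loop_poly:
  fixes A :: "'a :: idom mat"
  assumes A: "A \<in> carrier_mat n n" and B: "B \<in> carrier_mat n 1"
    and d: "d \<in> feedback_ideal A B" "degree d = n" "coeff d n = 1"
  obtains K where "K \<in> carrier_mat 1 n" "feedback_poly A B K = d - char_poly A"
proof -
  from d A obtain K u where K: "K \<in> carrier_mat 1 n"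
    and p: "d = feedback_poly A B K + char_poly A * u"
    unfolding feedback_ideal_def by auto
  have BK: "A - 1 \<cdot>\<^sub>m (B * K) \<in> carrier_mat n n" using A B K by auto
  have eq: "d - char_poly (A - 1 \<cdot>\<^sub>m (B * K)) = char_poly A * (u - 1)"
    unfolding char_poly_feedback[OF A B K] p by (simp add: algebra_simps)
  have "d = char_poly (A - 1 \<cdot>\<^sub>m (B * K))"
    by (rule monic_diff_eq_multiple[OF d(2,3) _ _ _ char_poly_nonzero[OF A] eq])
      (use degree_monic_char_poly[OF BK] degree_monic_char_poly[OF A] in auto)
  then show thesis using that[OF K] by (simp add: char_poly_feedback[OF A B K])
qed

section \<open>Robust stabilization\<close>

text \<open>The adjugate is avoided: \<open>feedback_poly\<close> is a difference of two
  characteristic polynomials, and these commute with ring homomorphisms.\<close>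

lemma feedback_poly_cnj:
  assumes A: "A \<in> carrier_mat n n" and B: "B \<in> carrier_mat n 1" and K: "K \<in> carrier_mat 1 n"
  shows "map_poly cnj (feedback_poly A B K)
    = feedback_poly (map_mat cnj A) (map_mat cnj B) (map_mat cnj K)"
proof -
  interpret c: comm_ring_hom cnj by (rule comm_ring_hom_cnj)
  interpret m: map_poly_comm_ring_hom cnj ..
  have fb: "feedback_poly X Y Z = char_poly (X - Y * Z) - char_poly X"
    if "X \<in> carrier_mat n n" "Y \<in> carrier_mat n 1" "Z \<in> carrier_mat 1 n" for X Y Z :: "complex mat"
  proof -
    have "1 \<cdot>\<^sub>m (Y * Z) = Y * Z" by (intro eq_matI) auto
    then show ?thesis using char_poly_feedback[OF that, of 1] by simp
  qed
  have "map_mat cnj (A - B * K) = map_mat cnj A - map_mat cnj (B * K)"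
    using A B K by (intro eq_matI) auto
  then have "map_mat cnj (A - B * K) = map_mat cnj A - map_mat cnj B * map_mat cnj K"
    by (simp add: c.mat_hom_mult[OF B K])
  moreover have "A - B * K \<in> carrier_mat n n" using A B K by auto
  ultimately show ?thesis
    using A B K by (simp add: fb m.hom_minus flip: c.char_poly_hom)
qed

text \<open>If the feedback polynomial is real, \<open>K\<close> and its conjugate give the same
  one; by linearity so does their average, the real part of \<open>K\<close>.\<close>

lemma real_feedback:
  fixes A B :: "real mat" and K :: "complex mat"
  assumes A: "A \<in> carrier_mat n n" and B: "B \<in> carrier_mat n 1" and K: "K \<in> carrier_mat 1 n"
    and real: "map_poly cnj (feedback_poly (cmat A) (cmat B) K) = feedback_poly (cmat A) (cmat B) K"
  shows "feedback_poly (cmat A) (cmat B) (cmat (map_mat Re K)) = feedback_poly (cmat A) (cmat B) K"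
proof -
  let ?P = "feedback_poly (cmat A) (cmat B)"
  have A': "cmat A \<in> carrier_mat n n" and B': "cmat B \<in> carrier_mat n 1"
    using A B by (auto simp: cmat_def)
  have cK: "map_mat cnj K \<in> carrier_mat 1 n" using K by auto
  have "map_mat cnj (cmat X) = cmat X" for X
    by (intro eq_matI) (auto simp: cmat_def)
  then have "?P (map_mat cnj K) = ?P K"
    using feedback_poly_cnj[OF A' B' K] real by simp
  moreover have "cmat (map_mat Re K) = (1/2) \<cdot>\<^sub>m (K + map_mat cnj K)"
    by (intro eq_matI) (auto simp: cmat_def complex_eq_iff)
  ultimately have "?P (cmat (map_mat Re K)) = Polynomial.smult (1/2) (?P K + ?P K)"
    using K by (simp add: feedback_poly_smult[OF A' B'] feedback_poly_add[OF A' B' K cK])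
  also have "\<dots> = ?P K"
    unfolding smult_add_right smult_add_left[symmetric] by simp
  finally show ?thesis .
qed

lemma reflection_feedback_exists:
  fixes A B :: "real mat"
  assumes A: "A \<in> carrier_mat n n" and B: "B \<in> carrier_mat n 1" and stab: "stabilizable n 1 A B"
  obtains K where "K \<in> carrier_mat 1 n"
    "feedback_poly (cmat A) (cmat B) (cmat K)
       = stable_reflection t (char_poly (cmat A)) - char_poly (cmat A)"
proof -
  interpret c: comm_ring_hom cnj by (rule comm_ring_hom_cnj)
  interpret m: map_poly_comm_ring_hom cnj ..
  let ?a = "char_poly (cmat A)" and ?I = "feedback_ideal (cmat A) (cmat B)"
  let ?d = "stable_reflection t ?a"
  let ?U = "filter_mset (\<lambda>x. 1 \<le> norm x) (proots ?a)"
  have A': "cmat A \<in> carrier_mat n n" and B': "cmat B \<in> carrier_mat n 1"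
    using A B by (auto simp: cmat_def)
  have monic: "degree ?a = n" "lead_coeff ?a = 1"
    using degree_monic_char_poly[OF A'] by auto
  have dec: "(\<Prod>x\<in>#proots ?a. [:- x, 1:]) = ?a"
    by (rule monic_complex_poly_decompose[OF monic(2)])
  from stab obtain K0 where K0: "K0 \<in> carrier_mat 1 n" and s0: "schur_stable (cmat (A - B * K0))"
    unfolding stabilizable_def by auto
  let ?d1 = "char_poly (cmat (A - B * K0))"
  have c0: "cmat (A - B * K0) = cmat A - cmat B * cmat K0"
  proof -
    have "cmat (A - B * K0) = cmat A - cmat (B * K0)"
      using A B K0 by (intro eq_matI) (auto simp: cmat_def)
    also have "cmat (B * K0) = cmat B * cmat K0"
      unfolding cmat_def by (rule of_real_hom.mat_hom_mult[OF B K0])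
    finally show ?thesis .
  qed
  have c0': "cmat (A - B * K0) \<in> carrier_mat n n"
    using A B K0 by (auto simp: cmat_def)
  have K0': "cmat K0 \<in> carrier_mat 1 n" using K0 by (auto simp: cmat_def)
  have d1: "?d1 \<in> ?I"
    unfolding c0 by (rule closed_loop_in_feedback_ideal[OF A' B' K0'])
  \<comment> \<open>Stabilizability enters here: \<open>?d1\<close> is an ideal member without
    unstable roots, so the unstable linear factors of \<open>?a\<close> can be cancelled.\<close>
  have "(\<Prod>x\<in>#filter_mset (\<lambda>x. \<not> 1 \<le> norm x) (proots ?a). [:- x, 1:]) \<in> ?I"
  proof (rule ideal_cancel_linear_factors[OF _ _ d1])
    show "\<forall>x\<in>#?U. poly ?d1 x \<noteq> 0"
      using s0 eigenvalue_root_char_poly[OF c0'] by (force simp: schur_stable_def)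
    have "(\<Prod>x\<in>#?U. [:- x, 1:]) * (\<Prod>x\<in>#filter_mset (\<lambda>x. \<not> 1 \<le> norm x) (proots ?a). [:- x, 1:]) = ?a"
      unfolding prod_mset.union[symmetric] image_mset_union[symmetric] multiset_partition[symmetric]
      by (rule dec)
    then show "(\<Prod>x\<in>#?U. [:- x, 1:]) * (\<Prod>x\<in>#filter_mset (\<lambda>x. \<not> 1 \<le> norm x) (proots ?a). [:- x, 1:]) \<in> ?I"
      using char_poly_in_feedback_ideal[OF A' B'] by simp
  qed (auto intro: feedback_ideal_add[OF A' B'] feedback_ideal_mult[OF A' B'])
  then have "?d \<in> ?I"
    unfolding stable_reflection_split by (rule feedback_ideal_mult[OF A' B'])
  moreover have "degree ?d = n"
    by (simp add: stable_reflection_def degree_linear_factors_mset size_proots_complex monic)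
  moreover from this have "coeff ?d n = 1"
    using lead_coeff_linear_factors[of "reflect_root t" "proots ?a"]
    by (simp add: stable_reflection_def)
  ultimately obtain K where K: "K \<in> carrier_mat 1 n"
    and fK: "feedback_poly (cmat A) (cmat B) K = ?d - ?a"
    by (rule feedback_of_closed_loop_poly[OF A' B'])
  \<comment> \<open>The gain found so far is complex; since \<open>?d - ?a\<close> has real
    coefficients, its real part does the same job.\<close>
  have "map_mat cnj (cmat A) = cmat A"
    by (intro eq_matI) (auto simp: cmat_def)
  then have cnj_a: "map_poly cnj ?a = ?a"
    using c.char_poly_hom[OF A'] by simp
  have "map_poly cnj (?d - ?a) = ?d - ?a"
    by (simp add: m.hom_minus cnj_a map_poly_cnj_stable_reflection[OF monic(2) cnj_a])
  then show thesis
    using that[of "map_mat Re K"] real_feedback[OF A B K] K by (simp add: fK)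
qed

section \<open>One gain for all multipliers near 1, and the choice of scaling\<close>

lemma prod_mset_norm_ge_1:
  fixes M :: "complex multiset"
  assumes "\<forall>x\<in>#M. 1 \<le> norm x"
  shows "1 \<le> (\<Prod>x\<in>#M. norm x)"
  using assms by (induction M) (auto intro: mult_ge1_I)

lemma robust_feedback:
  fixes A B :: "real mat"
  assumes A: "A \<in> carrier_mat n n" and B: "B \<in> carrier_mat n 1" and stab: "stabilizable n 1 A B"
    and \<delta>: "0 \<le> \<delta>"
      "prod_mset (image_mset norm (filter_mset (\<lambda>z. 1 \<le> norm z) (eigs (cmat A)))) * \<delta> < 1"
  obtains K where "K \<in> carrier_mat 1 n"
    "\<And>w. norm (1 - w) \<le> \<delta> \<Longrightarrow> schur_stable (cmat A - w \<cdot>\<^sub>m (cmat B * cmat K))"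
proof -
  let ?a = "char_poly (cmat A)"
  let ?U = "filter_mset (\<lambda>x. 1 \<le> norm x) (proots ?a)"
  define \<gamma> where "\<gamma> = (\<Prod>x\<in>#?U. norm x)"
  have A': "cmat A \<in> carrier_mat n n" and B': "cmat B \<in> carrier_mat n 1"
    using A B by (auto simp: cmat_def)
  have \<gamma>: "1 \<le> \<gamma>"
    unfolding \<gamma>_def by (rule prod_mset_norm_ge_1) simp
  have "\<gamma> * \<delta> < 1" using \<delta>(2) by (simp add: \<gamma>_def eigs_def)
  \<comment> \<open>Any \<open>g\<close> strictly between \<gamma> and 1/\<delta> serves, the gap
    above \<gamma> paying for \<open>t < 1\<close>. For \<delta> = 0 there is no upper limit, hence
    the separate witness.\<close>
  then obtain g where g: "\<gamma> < g" "g * \<delta> < 1"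
  proof (cases "\<delta> = 0")
    case False
    then have "\<gamma> < 1 / \<delta>" using \<delta>(1) \<open>\<gamma> * \<delta> < 1\<close> by (simp add: field_simps)
    then obtain g where "\<gamma> < g" "g < 1 / \<delta>" using dense by blast
    then show thesis using that[of g] \<delta>(1) False by (simp add: field_simps)
  qed (use that[of "\<gamma> + 1"] in auto)
  obtain t where t: "0 < t" "t < 1" "(2 / (1 + t)) ^ size ?U * \<gamma> < g"
    using exists_reflection_parameter[OF g(1)] .
  let ?d = "stable_reflection t ?a"
  obtain K where K: "K \<in> carrier_mat 1 n" and fK: "feedback_poly (cmat A) (cmat B) (cmat K) = ?d - ?a"
    using reflection_feedback_exists[OF A B stab] .
  have K': "cmat K \<in> carrier_mat 1 n" using K by (auto simp: cmat_def)
  \<comment> \<open>The centre of the Apollonius disk: scaling the gain by \<open>c\<close> sends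
    the disk of radius \<delta> about 1 to one of radius c \<delta> < c/g about
    \<open>c\<close>.\<close>
  define c where "c = g\<^sup>2 / (g\<^sup>2 - 1)"
  have g1: "1 < g" using g \<gamma> by simp
  then have c: "0 < c" by (simp add: c_def)
  have bound: "norm (poly ?a z) \<le> g * norm (poly ?d z)" "poly ?d z \<noteq> 0" if z: "1 \<le> norm z" for z
  proof -
    have "poly ?a z = poly (\<Prod>x\<in>#proots ?a. [:- x, 1:]) z"
      using monic_complex_poly_decompose[of ?a] degree_monic_char_poly[OF A'] by simp
    also have "\<dots> = (\<Prod>x\<in>#proots ?a. z - x)" by (rule poly_linear_factors)
    also have "norm \<dots> \<le> (2 / (1 + t)) ^ size ?U * \<gamma> * norm (\<Prod>x\<in>#proots ?a. z - reflect_root t x)"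
      unfolding \<gamma>_def by (rule norm_linear_factors_le_reflected[OF t(1,2) z])
    also have "\<dots> \<le> g * norm (\<Prod>x\<in>#proots ?a. z - reflect_root t x)"
      using t(3) by (intro mult_right_mono) auto
    finally show "norm (poly ?a z) \<le> g * norm (poly ?d z)"
      by (simp add: stable_reflection_def poly_linear_factors)
    have "z \<noteq> reflect_root t x" for x
      using norm_reflect_less[OF t(1,2), of x] z by auto
    then show "poly ?d z \<noteq> 0"
      unfolding stable_reflection_def poly_linear_factors by auto
  qed
  have "schur_stable (cmat A - w \<cdot>\<^sub>m (cmat B * cmat (c \<cdot>\<^sub>m K)))" if w: "norm (1 - w) \<le> \<delta>" for w
    unfolding schur_stable_def
  proof (intro allI impI)
    fix z
    define s where "s = w * of_real c"
    have "cmat B * cmat (c \<cdot>\<^sub>m K) = of_real c \<cdot>\<^sub>m (cmat B * cmat K)"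
    proof -
      have "cmat (c \<cdot>\<^sub>m K) = of_real c \<cdot>\<^sub>m cmat K" by (intro eq_matI) (auto simp: cmat_def)
      then show ?thesis using mult_smult_distrib[OF B' K'] by simp
    qed
    then have eq: "w \<cdot>\<^sub>m (cmat B * cmat (c \<cdot>\<^sub>m K)) = s \<cdot>\<^sub>m (cmat B * cmat K)"
      by (intro eq_matI) (auto simp: s_def)
    assume "eigenvalue (cmat A - w \<cdot>\<^sub>m (cmat B * cmat (c \<cdot>\<^sub>m K))) z"
    then have "poly (char_poly (cmat A - s \<cdot>\<^sub>m (cmat B * cmat K))) z = 0"
      unfolding eq by (subst (asm) eigenvalue_root_char_poly[of _ n]) (use A' B' K' in auto)
    \<comment> \<open>By the choice of \<open>K\<close> the closed-loop polynomial is (1 - s) a + s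
      d.\<close>
    then have root: "poly ?a z + s * (poly ?d z - poly ?a z) = 0"
      by (simp add: char_poly_feedback[OF A' B' K'] fK)
    show "norm z < 1"
    proof (rule ccontr)
      assume "\<not> norm z < 1"
      then have z: "1 \<le> norm z" by simp
      have "s - of_real c = - (of_real c * (1 - w))" by (simp add: s_def algebra_simps)
      then have "norm (s - of_real c) = c * norm (1 - w)"
        using c by (simp add: norm_mult)
      also have "\<dots> \<le> c * \<delta>" using w c by simp
      also have "\<dots> < c / g" using g(2) g1 c by (simp add: field_simps)
      finally have *: "g * norm (1 - s) < norm s"
        by (rule norm_gt_Apollonius[OF g1 c_def])
      \<comment> \<open>At an unstable root the two summands have equal modulus, but the bound on
        \<open>?a\<close> and the Apollonius inequality make the \<open>?d\<close> summand strictly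
        larger, as \<open>?d\<close> does not vanish there.\<close>
      have "s * poly ?d z = - ((1 - s) * poly ?a z)" using root by (simp add: algebra_simps)
      then have "norm s * norm (poly ?d z) = norm (1 - s) * norm (poly ?a z)"
        by (metis norm_minus_cancel norm_mult)
      also have "\<dots> \<le> norm (1 - s) * (g * norm (poly ?d z))"
        using bound(1)[OF z] by (intro mult_left_mono) auto
      also have "\<dots> = (g * norm (1 - s)) * norm (poly ?d z)" by simp
      also have "\<dots> < norm s * norm (poly ?d z)"
        using * bound(2)[OF z] by (intro mult_strict_right_mono) auto
      finally show False by simp
    qed
  qed
  then show thesis using that[of "c \<cdot>\<^sub>m K"] K by simp
qed

theorem theorem2:
  fixes n N :: nat and A B a :: "real mat"
  assumes A: "A \<in> carrier_mat n n" and B: "B \<in> carrier_mat n 1"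
    and adj: "a \<in> carrier_mat N N"
    and diag0: "\<forall>i<N. a $$ (i,i) = 0"
    and nonneg: "\<forall>i<N. \<forall>j<N. 0 \<le> a $$ (i,j)"
    and stab: "stabilizable n 1 A B"
    and cond: "unstable_prod A * inf_max (lap_eigs N a) < 1"
  shows "\<exists>K \<in> carrier_mat 1 n. \<forall>l \<in># lap_eigs N a.
           schur_stable (cmat A - l \<cdot>\<^sub>m (cmat B * cmat K))"
proof (cases "spectral_radius (cmat A) < 1 \<or> lap_eigs N a = {#}")
  \<comment> \<open>For spectral radius below 1 the zero gain suffices. An empty multiset leaves
    nothing to prove; it is split off because \<open>Max\<close> of the empty set is
    unspecified.\<close>
  case True
  have A': "cmat A \<in> carrier_mat n n"
    using A by (auto simp: cmat_def)
  have "schur_stable (cmat A)" if sr: "spectral_radius (cmat A) < 1"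
    unfolding schur_stable_def
  proof (intro allI impI)
    fix z assume z: "eigenvalue (cmat A) z"
    have "norm z \<le> spectral_radius (cmat A)"
      unfolding spectral_radius_def using card_finite_spectrum(1)[OF A'] z
      by (intro Max_ge) (auto simp: spectrum_def)
    then show "norm z < 1" using sr by simp
  qed
  moreover have "cmat A - l \<cdot>\<^sub>m (cmat B * cmat (0\<^sub>m 1 n)) = cmat A" for l
    using A B by (intro eq_matI) (auto simp: cmat_def scalar_prod_def)
  ultimately show ?thesis using True by (intro bexI[of _ "0\<^sub>m 1 n"]) auto
next
  case False
  let ?P = "prod_mset (image_mset norm (filter_mset (\<lambda>z. 1 \<le> norm z) (eigs (cmat A))))"
  let ?m = "\<lambda>\<omega>. Max ((\<lambda>z. norm (1 - complex_of_real \<omega> * z)) ` set_mset (lap_eigs N a))"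
  have "?P * inf_max (lap_eigs N a) < 1"
    using cond False by (simp add: unstable_prod_def)
  \<comment> \<open>Positivity of the product allows division by it; the product form of the
    hypothesis also covers an infimum equal to 0.\<close>
  moreover have "1 \<le> ?P"
    by (rule prod_mset_norm_ge_1) simp
  then have P: "0 < ?P" by simp
  ultimately have "inf_max (lap_eigs N a) < 1 / ?P"
    by (simp add: field_simps)
  \<comment> \<open>The infimum need not be attained: if every value were at least
    \<open>1 / ?P\<close>, so would the infimum be.\<close>
  then obtain \<omega> where "?m \<omega> < 1 / ?P"
    unfolding inf_max_def using cINF_greatest[of UNIV "1 / ?P" ?m]
    by (meson UNIV_I UNIV_not_empty not_le)
  then have m: "?P * ?m \<omega> < 1" using P by (simp add: field_simps)
  have le: "norm (1 - complex_of_real \<omega> * l) \<le> ?m \<omega>" if "l \<in># lap_eigs N a" for l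
    using that by (intro Max_ge) auto
  have "0 \<le> ?m \<omega>"
    using False le norm_ge_zero order_trans by (metis multiset_nonemptyE)
  from robust_feedback[OF A B stab this m] obtain K where K: "K \<in> carrier_mat 1 n"
    and rob: "\<And>w. norm (1 - w) \<le> ?m \<omega> \<Longrightarrow> schur_stable (cmat A - w \<cdot>\<^sub>m (cmat B * cmat K))"
    by blast
  \<comment> \<open>The witness is \<omega> K: the eigenvalue \<open>l\<close> then acts as the
    multiplier w = \<omega> l, whose distance from 1 is at most \<open>?m \<omega>\<close>.\<close>
  show ?thesis
  proof (intro bexI ballI)
    fix l assume l: "l \<in># lap_eigs N a"
    have "cmat (\<omega> \<cdot>\<^sub>m K) = of_real \<omega> \<cdot>\<^sub>m cmat K" by (intro eq_matI) (auto simp: cmat_def)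
    then have "cmat B * cmat (\<omega> \<cdot>\<^sub>m K) = of_real \<omega> \<cdot>\<^sub>m (cmat B * cmat K)"
      using mult_smult_distrib[of "cmat B" n 1 "cmat K" n] B K by (auto simp: cmat_def)
    then have "l \<cdot>\<^sub>m (cmat B * cmat (\<omega> \<cdot>\<^sub>m K)) = (of_real \<omega> * l) \<cdot>\<^sub>m (cmat B * cmat K)"
      by (intro eq_matI) auto
    then show "schur_stable (cmat A - l \<cdot>\<^sub>m (cmat B * cmat (\<omega> \<cdot>\<^sub>m K)))"
      using rob[OF le[OF l]] by simp
  qed (use K in auto)
qed

end
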